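(* The Finsler band model $(\mathbb{B},F_B)$ and the Funk disc $(\mathbb{D},F_F)$ are isometric to each other; that is, there is a diffeomorphism $\xi:\mathbb{D}\to\mathbb{B}$ such that $F_B(\xi(x),D\xi_x(v))=F_F(x,v)$ for all $(x,v)\in T\mathbb{D}$.
   Context: Coordinates are written with subscripts, $x=(x_1,x_2)$, $v=(v_1,v_2)$; $|\cdot|$ and $\langle\cdot,\cdot\rangle$ are the Euclidean norm and inner product. $\mathbb{B}=\{(x_1,x_2)\in\mathbb{R}^2:-\frac{\pi}{2}<x_2<\frac{\pi}{2}\}$ with $F_B(x,v)=\dfrac{|v|}{\cos x_2}+\dfrac{(e^{2x_1}-4)v_1\cos x_2+(e^{2x_1}+4)v_2\sin x_2}{(e^{2x_1}+4)\cos x_2}$. $\mathbb{D}=\{x\in\mathbb{R}^2:|x|<1\}$ with the Funk metric $F_F(x,v)=\dfrac{\sqrt{(1-|x|^2)|v|^2+\langle x,v\rangle^2}}{1-|x|^2}+\dfrac{\langle x,v\rangle}{1-|x|^2}$. *)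

theory Defs
  imports "HOL-Analysis.Analysis"
begin

text \<open>
  \<open>Ck_on k S f\<close> says that \<open>f\<close> is of class \<open>C\<^sup>k\<close> on the set \<open>S\<close>, which must be open for
  this reading: continuity of all directional derivatives
  \<open>x \<mapsto> Df\<^sub>x(v)\<close> amounts, in finite dimension, to continuity of \<open>x \<mapsto> Df\<^sub>x\<close>.
\<close>

primrec Ck_on ::
  "nat \<Rightarrow> 'a::euclidean_space set \<Rightarrow> ('a \<Rightarrow> 'b::euclidean_space) \<Rightarrow> bool" where
  "Ck_on 0 S f \<longleftrightarrow> continuous_on S f"
| "Ck_on (Suc k) S f \<longleftrightarrow>
     (\<forall>x\<in>S. f differentiable (at x)) \<and>
     (\<forall>v. Ck_on k S (\<lambda>x. frechet_derivative f (at x) v))"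

definition smooth_on ::
  "'a::euclidean_space set \<Rightarrow> ('a \<Rightarrow> 'b::euclidean_space) \<Rightarrow> bool" where
  "smooth_on S f \<longleftrightarrow> (\<forall>k. Ck_on k S f)"

definition diffeomorphism ::
  "'a::euclidean_space set \<Rightarrow> 'b::euclidean_space set \<Rightarrow> ('a \<Rightarrow> 'b) \<Rightarrow> bool" where
  "diffeomorphism S T f \<longleftrightarrow> open S \<and> open T \<and>
     (\<exists>g. homeomorphism S T f g \<and> smooth_on S f \<and> smooth_on T g)"

definition band :: "(real^2) set" where
  "band = {x. - (pi / 2) < x $ 2 \<and> x $ 2 < pi / 2}"

definition F_B :: "real^2 \<Rightarrow> real^2 \<Rightarrow> real" where
  "F_B x v = norm v / cos (x $ 2) +
     ((exp (2 * x $ 1) - 4) * v $ 1 * cos (x $ 2) + (exp (2 * x $ 1) + 4) * v $ 2 * sin (x $ 2))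
       / ((exp (2 * x $ 1) + 4) * cos (x $ 2))"

definition disc :: "(real^2) set" where
  "disc = {x. norm x < 1}"

definition F_F :: "real^2 \<Rightarrow> real^2 \<Rightarrow> real" where
  "F_F x v = sqrt ((1 - (norm x)\<^sup>2) * (norm v)\<^sup>2 + (x \<bullet> v)\<^sup>2) / (1 - (norm x)\<^sup>2)
     + (x \<bullet> v) / (1 - (norm x)\<^sup>2)"

text \<open>
  An isometry of open subsets of Euclidean space carrying (not necessarily reversible) Finsler
  structures \<open>F\<close> and \<open>G\<close>; \<open>T\<^sub>xS\<close> is identified with the ambient space.
\<close>

definition finsler_isometry ::
  "'a::euclidean_space set \<Rightarrow> ('a \<Rightarrow> 'a \<Rightarrow> real) \<Rightarrow>
   'b::euclidean_space set \<Rightarrow> ('b \<Rightarrow> 'b \<Rightarrow> real) \<Rightarrow> ('a \<Rightarrow> 'b) \<Rightarrow> bool" where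
  "finsler_isometry S F T G f \<longleftrightarrow> diffeomorphism S T f \<and>
     (\<forall>x\<in>S. \<forall>v. G (f x) (frechet_derivative f (at x) v) = F x v)"

end

theory Submission imports Defs begin

text \<open>
  On the hyperboloid \<open>X\<^sub>0\<^sup>2 = 1 + X\<^sub>1\<^sup>2 + X\<^sub>2\<^sup>2\<close> both structures are the hyperbolic norm plus
  \<open>d (ln X\<^sub>0)\<close>. The disc is the Klein chart \<open>x = (X\<^sub>1 / X\<^sub>0, X\<^sub>2 / X\<^sub>0)\<close>, and with
  \<open>u = z\<^sub>1 - ln 2\<close> the band is the chart \<open>X = (cosh u, sinh u, sin z\<^sub>2) / cos z\<^sub>2\<close>. The change of
  charts is therefore \<open>z = (ln 2 + artanh x\<^sub>1, arctan X\<^sub>2)\<close> with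
  \<open>X\<^sub>2 = x\<^sub>2 / sqrt (1 - |x|\<^sup>2)\<close>, and its inverse is \<open>x = (tanh u, sin z\<^sub>2 / cosh u)\<close>.
\<close>

section \<open>Calculus of smooth maps\<close>

text \<open>Because \<open>S\<close> is open, equality on \<open>S\<close> is equality near each of
  its points, so both maps have the same derivatives there. Generalizing over \<open>f\<close> and
  \<open>g\<close> lets the induction pass to directional derivatives.\<close>

lemma Ck_on_cong:
  assumes "open S" and "\<And>x. x \<in> S \<Longrightarrow> f x = g x" and "Ck_on k S f"
  shows "Ck_on k S g"
  using assms(2,3)
proof (induction k arbitrary: f g)
  case 0
  then show ?case by (simp cong: continuous_on_cong)
next
  case (Suc k)
  have der: "(f has_derivative D) (at x) \<longleftrightarrow> (g has_derivative D) (at x)" if "x \<in> S" for x D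
    using has_derivative_transform_within_open[OF _ \<open>open S\<close> that] Suc.prems(1) by metis
  then have "frechet_derivative f (at x) v = frechet_derivative g (at x) v" if "x \<in> S" for x v
    using that by (simp add: frechet_derivative_def)
  then have "Ck_on k S (\<lambda>x. frechet_derivative g (at x) v)" for v
    by (rule Suc.IH) (use Suc.prems(2) in auto)
  moreover have "\<forall>x\<in>S. g differentiable (at x)"
    using Suc.prems(2) der by (simp add: differentiable_def)
  ultimately show ?case
    by simp
qed

text \<open>Uniqueness of the derivative lets an explicit formula \<open>f'\<close> stand in for
  \<open>frechet_derivative\<close>, which is defined by choice. The rules for sums, products and
  composites rest on this.\<close>

lemma Ck_on_SucI:
  assumes "open S" and "\<And>x. x \<in> S \<Longrightarrow> (f has_derivative f' x) (at x)"
    and "\<And>v. Ck_on k S (\<lambda>x. f' x v)"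
  shows "Ck_on (Suc k) S f"
proof -
  have "Ck_on k S (\<lambda>x. frechet_derivative f (at x) v)" for v
    by (rule Ck_on_cong[OF assms(1) _ assms(3)]) (simp add: frechet_derivative_at[OF assms(2)])
  then show ?thesis
    using assms(2) by (auto simp: differentiable_def)
qed

lemma Ck_on_Suc_has_derivative:
  "Ck_on (Suc k) S f \<Longrightarrow> x \<in> S \<Longrightarrow> (f has_derivative frechet_derivative f (at x)) (at x)"
  by (simp add: frechet_derivative_works)

text \<open>The product and chain rules leave some factors undifferentiated; this brings them down
  to the order of the differentiated ones.\<close>

lemma Ck_on_SucD: "Ck_on (Suc k) S f \<Longrightarrow> Ck_on k S f"
proof (induction k arbitrary: f)
  case 0
  then show ?case
    by (auto intro!: continuous_at_imp_continuous_on differentiable_imp_continuous_within)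
next
  case (Suc k)
  then have "\<forall>x\<in>S. f differentiable (at x)"
    and "Ck_on (Suc k) S (\<lambda>x. frechet_derivative f (at x) v)" for v
    by (auto simp only: Ck_on.simps(2)[of "Suc k"])
  then show ?case
    using Suc.IH by simp
qed

lemma Ck_on_const: "open S \<Longrightarrow> Ck_on k S (\<lambda>x. c)"
proof (induction k arbitrary: c)
  case (Suc k)
  show ?case
    by (rule Ck_on_SucI[OF Suc.prems, where f' = "\<lambda>x v. 0"]) (simp_all add: Suc)
qed simp

lemma Ck_on_bounded_linear:
  assumes "open S" and "bounded_linear h"
  shows "Ck_on k S h"
proof (cases k)
  case 0
  then show ?thesis
    using assms(2) by (simp add: linear_continuous_on)
next
  case (Suc m)
  then show ?thesis
    using assms Ck_on_SucI[OF assms(1) bounded_linear_imp_has_derivative[OF assms(2)]]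
    by (simp add: Ck_on_const)
qed

lemma Ck_on_add:
  assumes "open S" and "Ck_on k S f" and "Ck_on k S g"
  shows "Ck_on k S (\<lambda>x. f x + g x)"
  using assms(2,3)
proof (induction k arbitrary: f g)
  case 0
  then show ?case by (simp add: continuous_on_add)
next
  case (Suc k)
  show ?case
  proof (rule Ck_on_SucI[OF assms(1)])
    show "((\<lambda>x. f x + g x) has_derivative
        (\<lambda>v. frechet_derivative f (at x) v + frechet_derivative g (at x) v)) (at x)" if "x \<in> S" for x
      by (rule has_derivative_add[OF Suc.prems[THEN Ck_on_Suc_has_derivative, OF that]])
  qed (use Suc in auto)
qed

lemma Ck_on_sum:
  assumes "open S" and "finite I" and "\<And>i. i \<in> I \<Longrightarrow> Ck_on k S (f i)"
  shows "Ck_on k S (\<lambda>x. \<Sum>i\<in>I. f i x)"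
  using assms(2,3) by (induction I) (auto simp: Ck_on_const Ck_on_add assms(1))

lemma Ck_on_scaleR:
  fixes f :: "'a::euclidean_space \<Rightarrow> real"
  assumes "open S" and "Ck_on k S f" and "Ck_on k S g"
  shows "Ck_on k S (\<lambda>x. f x *\<^sub>R g x)"
  using assms(2,3)
proof (induction k arbitrary: f g)
  case 0
  then show ?case by (simp add: continuous_on_scaleR)
next
  case (Suc k)
  show ?case
  proof (rule Ck_on_SucI[OF assms(1)])
    show "((\<lambda>x. f x *\<^sub>R g x) has_derivative
        (\<lambda>v. f x *\<^sub>R frechet_derivative g (at x) v + frechet_derivative f (at x) v *\<^sub>R g x)) (at x)"
      if "x \<in> S" for x
      by (rule has_derivative_scaleR[OF Suc.prems[THEN Ck_on_Suc_has_derivative, OF that]])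
    show "Ck_on k S (\<lambda>x. f x *\<^sub>R frechet_derivative g (at x) v
        + frechet_derivative f (at x) v *\<^sub>R g x)" for v
      using Suc.prems Ck_on_SucD[OF Suc.prems(1)] Ck_on_SucD[OF Suc.prems(2)]
      by (intro Ck_on_add assms(1) Suc.IH) auto
  qed
qed

text \<open>A bounded linear map is its own derivative, so differentiating only replaces
  \<open>f\<close> by one of its directional derivatives. The later uses are taking components and
  changing sign.\<close>

lemma Ck_on_linear_compose:
  assumes "open S" and "bounded_linear h" and "Ck_on k S f"
  shows "Ck_on k S (\<lambda>x. h (f x))"
  using assms(3)
proof (induction k arbitrary: f)
  case 0
  then show ?case
    using bounded_linear.continuous_on[OF assms(2)] by simp
next
  case (Suc k)
  show ?case
  proof (rule Ck_on_SucI[OF assms(1)])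
    show "((\<lambda>x. h (f x)) has_derivative (\<lambda>v. h (frechet_derivative f (at x) v))) (at x)"
      if "x \<in> S" for x
      by (rule bounded_linear.has_derivative[OF assms(2) Ck_on_Suc_has_derivative[OF Suc.prems that]])
  qed (use Suc in auto)
qed

text \<open>In \<open>?g' x (?f' x v)\<close> the direction itself varies with \<open>x\<close>, so
  the induction hypothesis does not apply directly. Expanding that direction in the basis gives
  scalar components of \<open>?f' x v\<close> times derivatives of \<open>g\<close> in fixed
  directions \<open>b\<close>, composed with \<open>f\<close>. The hypothesis covers these because
  it is general in \<open>g\<close>.\<close>

lemma Ck_on_compose:
  fixes f :: "'a::euclidean_space \<Rightarrow> 'b::euclidean_space"
  assumes "open S" and "open T" and "Ck_on k T g" and "Ck_on k S f"
    and "\<And>x. x \<in> S \<Longrightarrow> f x \<in> T"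
  shows "Ck_on k S (\<lambda>x. g (f x))"
  using assms(3,4)
proof (induction k arbitrary: g)
  case 0
  then show ?case
    using assms(5) by (auto intro: continuous_on_compose2)
next
  case (Suc k)
  let ?f' = "\<lambda>x. frechet_derivative f (at x)"
  let ?g' = "\<lambda>x. frechet_derivative g (at (f x))"
  show ?case
  proof (rule Ck_on_SucI[OF assms(1)])
    show "((\<lambda>x. g (f x)) has_derivative (\<lambda>v. \<Sum>b\<in>Basis. (?f' x v \<bullet> b) *\<^sub>R ?g' x b)) (at x)"
      if "x \<in> S" for x
    proof -
      have g': "(g has_derivative ?g' x) (at (f x))"
        using Ck_on_Suc_has_derivative[OF Suc.prems(1)] assms(5) that by blast
      have sum: "?g' x w = (\<Sum>b\<in>Basis. (w \<bullet> b) *\<^sub>R ?g' x b)" for w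
      proof -
        have "?g' x w = ?g' x (\<Sum>b\<in>Basis. (w \<bullet> b) *\<^sub>R b)"
          by (simp add: euclidean_representation)
        then show ?thesis
          using has_derivative_linear[OF g'] by (simp add: linear_sum linear_cmul)
      qed
      have "((\<lambda>x. g (f x)) has_derivative (\<lambda>v. ?g' x (?f' x v))) (at x)"
        using has_derivative_compose[OF Ck_on_Suc_has_derivative[OF Suc.prems(2) that] g'] .
      then show ?thesis
        by (rule has_derivative_eq_rhs) (rule ext, rule sum)
    qed
    show "Ck_on k S (\<lambda>x. \<Sum>b\<in>Basis. (?f' x v \<bullet> b) *\<^sub>R ?g' x b)" for v
      using Suc.prems Ck_on_SucD[OF Suc.prems(2)]
      by (intro Ck_on_sum Ck_on_scaleR assms(1) finite_Basis
          Ck_on_linear_compose[OF assms(1) bounded_linear_inner_left] Suc.IH) auto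
  qed
qed

section \<open>Closure properties of smooth maps\<close>

lemma smooth_on_const: "open S \<Longrightarrow> smooth_on S (\<lambda>x. c)"
  by (simp add: smooth_on_def Ck_on_const)

lemma smooth_on_bounded_linear: "open S \<Longrightarrow> bounded_linear h \<Longrightarrow> smooth_on S h"
  by (simp add: smooth_on_def Ck_on_bounded_linear)

lemma smooth_on_add:
  "open S \<Longrightarrow> smooth_on S f \<Longrightarrow> smooth_on S g \<Longrightarrow> smooth_on S (\<lambda>x. f x + g x)"
  by (simp add: smooth_on_def Ck_on_add)

lemma smooth_on_scaleR:
  fixes f :: "'a::euclidean_space \<Rightarrow> real"
  shows "open S \<Longrightarrow> smooth_on S f \<Longrightarrow> smooth_on S g \<Longrightarrow> smooth_on S (\<lambda>x. f x *\<^sub>R g x)"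
  by (simp add: smooth_on_def Ck_on_scaleR)

lemma smooth_on_mult:
  fixes f g :: "'a::euclidean_space \<Rightarrow> real"
  shows "open S \<Longrightarrow> smooth_on S f \<Longrightarrow> smooth_on S g \<Longrightarrow> smooth_on S (\<lambda>x. f x * g x)"
  using smooth_on_scaleR[of S f g] by simp

lemma smooth_on_compose:
  assumes "smooth_on T g" and "open T" and "open S" and "smooth_on S f" and "\<And>x. x \<in> S \<Longrightarrow> f x \<in> T"
  shows "smooth_on S (\<lambda>x. g (f x))"
  using assms by (auto simp: smooth_on_def intro: Ck_on_compose)

lemma smooth_on_minus:
  fixes f g :: "'a::euclidean_space \<Rightarrow> real"
  assumes "open S" and "smooth_on S f" and "smooth_on S g"
  shows "smooth_on S (\<lambda>x. f x - g x)"
  using smooth_on_add[OF assms(1,2) smooth_on_mult[OF assms(1) smooth_on_const[OF assms(1), of "-1"] assms(3)]]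
  by simp

lemma Ck_on_Suc_real:
  fixes h h' :: "real \<Rightarrow> real"
  assumes "open T" and "\<And>x. x \<in> T \<Longrightarrow> (h has_real_derivative h' x) (at x)" and "Ck_on k T h'"
  shows "Ck_on (Suc k) T h"
proof (rule Ck_on_SucI[OF assms(1)])
  show "(h has_derivative (*) (h' x)) (at x)" if "x \<in> T" for x
    using assms(2)[OF that] by (simp add: has_field_derivative_def)
  show "Ck_on k T (\<lambda>x. h' x * v)" for v
    using Ck_on_scaleR[OF assms(1,3) Ck_on_const[OF assms(1)], of v] by simp
qed

text \<open>If \<open>h'\<close> has order \<open>k\<close>, then \<open>h\<close> has order
  \<open>Suc k\<close> and hence order \<open>k\<close>. This reduces \<open>arctan\<close> and
  \<open>ln\<close> to rational functions.\<close>

lemma smooth_on_real_derivative: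
  fixes h h' :: "real \<Rightarrow> real"
  assumes "open T" and "\<And>x. x \<in> T \<Longrightarrow> (h has_real_derivative h' x) (at x)" and "smooth_on T h'"
  shows "smooth_on T h"
  unfolding smooth_on_def using Ck_on_Suc_real[OF assms(1,2)] assms(3)[unfolded smooth_on_def]
  by (blast intro: Ck_on_SucD)

section \<open>Smoothness of the elementary functions\<close>

lemma smooth_on_exp: "smooth_on UNIV (exp :: real \<Rightarrow> real)"
  unfolding smooth_on_def
proof
  show "Ck_on k UNIV (exp :: real \<Rightarrow> real)" for k
    by (induction k)
      (auto intro!: Ck_on_Suc_real[where h = exp and h' = exp] continuous_intros DERIV_exp
        simp del: Ck_on.simps(2))
qed

lemma smooth_on_sin: "smooth_on UNIV (sin :: real \<Rightarrow> real)"
proof -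
  \<comment> \<open>Each function is, up to sign, the derivative of the other, so the induction
    carries both.\<close>
  have "Ck_on k UNIV (sin :: real \<Rightarrow> real) \<and> Ck_on k UNIV (cos :: real \<Rightarrow> real)" for k
  proof (induction k)
    case 0
    show ?case by (auto intro!: continuous_intros)
  next
    case (Suc k)
    have "Ck_on k UNIV (\<lambda>x::real. - sin x)"
      using Ck_on_linear_compose[OF open_UNIV bounded_linear_minus[OF bounded_linear_ident]] Suc by blast
    then show ?case
      using Suc Ck_on_Suc_real[OF open_UNIV DERIV_sin] Ck_on_Suc_real[OF open_UNIV DERIV_cos] by blast
  qed
  then show ?thesis by (simp add: smooth_on_def)
qed

text \<open>The derivative is minus the square of the function itself, so the product rule at order
  \<open>k\<close> yields order \<open>Suc k\<close>.\<close>

lemma smooth_on_inverse: "smooth_on (- {0}) (inverse :: real \<Rightarrow> real)"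
  unfolding smooth_on_def
proof
  have op: "open (- {0::real})" by auto
  show "Ck_on k (- {0}) (inverse :: real \<Rightarrow> real)" for k
  proof (induction k)
    case 0
    show ?case by (auto intro!: continuous_intros)
  next
    case (Suc k)
    have "Ck_on k (- {0}) (\<lambda>x::real. - (inverse x *\<^sub>R inverse x))"
      by (rule Ck_on_linear_compose[OF op bounded_linear_minus[OF bounded_linear_ident]])
        (rule Ck_on_scaleR[OF op Suc Suc])
    then show ?case
      by (rule Ck_on_Suc_real[OF op, rotated]) (auto intro!: derivative_eq_intros simp: power2_eq_square)
  qed
qed

lemma smooth_on_divide:
  fixes f g :: "'a::euclidean_space \<Rightarrow> real"
  assumes "open S" and "smooth_on S f" and "smooth_on S g" and "\<And>x. x \<in> S \<Longrightarrow> g x \<noteq> 0"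
  shows "smooth_on S (\<lambda>x. f x / g x)"
  unfolding divide_inverse
  by (intro smooth_on_mult assms smooth_on_compose[OF smooth_on_inverse]) (use assms in auto)

lemma smooth_on_arctan: "smooth_on UNIV arctan"
proof (rule smooth_on_real_derivative)
  show "(arctan has_real_derivative 1 / (1 + x * x)) (at x)" for x
    using DERIV_arctan[of x] by (simp add: power2_eq_square inverse_eq_divide)
  show "smooth_on UNIV (\<lambda>x::real. 1 / (1 + x * x))"
    by (intro smooth_on_divide smooth_on_add smooth_on_mult smooth_on_const smooth_on_bounded_linear
        bounded_linear_ident open_UNIV) (simp add: add_pos_nonneg order_less_imp_not_eq2)
qed simp

lemma smooth_on_ln: "smooth_on {0<..} (ln :: real \<Rightarrow> real)"
proof (rule smooth_on_real_derivative)
  show "(ln has_real_derivative 1 / x) (at x)" if "x \<in> {0<..}" for x :: real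
    using that by (auto intro!: derivative_eq_intros)
  show "smooth_on {0<..} (\<lambda>x::real. 1 / x)"
    by (rule smooth_on_divide) (auto intro: smooth_on_const smooth_on_bounded_linear bounded_linear_ident)
qed simp

text \<open>On the positive reals \<open>sqrt x = exp (ln x / 2)\<close>, a composite of functions
  already known to be smooth.\<close>

lemma smooth_on_sqrt: "smooth_on {0<..} sqrt"
proof -
  have "smooth_on {0<..} (\<lambda>x::real. exp (ln x / 2))"
    by (intro smooth_on_compose[OF smooth_on_exp] smooth_on_divide smooth_on_ln smooth_on_const) auto
  moreover have "exp (ln x / 2) = sqrt x" if "x > 0" for x :: real
    using that by (simp add: ln_sqrt [symmetric])
  ultimately show ?thesis
    unfolding smooth_on_def
    using Ck_on_cong[OF open_greaterThan, of 0 "\<lambda>x. exp (ln x / 2)" sqrt] by simp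
qed

section \<open>The change of charts\<close>

lemma open_disc: "open disc"
proof -
  have "disc = ball 0 1" by (auto simp: disc_def)
  then show ?thesis by (metis open_ball)
qed

lemma open_band: "open band"
  unfolding band_def by (intro open_Collect_conj open_Collect_less continuous_intros)

lemma norm_power2_vec2: "(norm (v :: real^2))\<^sup>2 = (v $ 1)\<^sup>2 + (v $ 2)\<^sup>2"
proof -
  have "(norm v)\<^sup>2 = v \<bullet> v" by (rule power2_norm_eq_inner)
  also have "\<dots> = (v $ 1)\<^sup>2 + (v $ 2)\<^sup>2"
    by (simp only: inner_vec_def sum_2 inner_real_def power2_eq_square)
  finally show ?thesis .
qed

lemma norm_vec2: "norm (v :: real^2) = sqrt ((v $ 1)\<^sup>2 + (v $ 2)\<^sup>2)"
  unfolding norm_power2_vec2[symmetric] by simp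

lemma disc_iff: "x \<in> disc \<longleftrightarrow> (x $ 1)\<^sup>2 + (x $ 2)\<^sup>2 < 1"
  by (simp add: disc_def norm_vec2)

lemma disc_fst_bounds:
  assumes "x \<in> disc"
  shows "-1 < x $ 1" and "x $ 1 < 1"
proof -
  have "(x $ 1)\<^sup>2 < 1"
    using assms zero_le_power2[of "x $ 2"] unfolding disc_iff by linarith
  then show "-1 < x $ 1" "x $ 1 < 1"
    by (auto simp: abs_square_less_1)
qed

text \<open>Half the difference of the logarithms is artanh of \<open>x $ 1\<close>. Squares are
  written as products and the vector as a combination of axes, so that the rules for
  \<open>smooth_on\<close> apply structurally.\<close>

definition band_of_disc :: "real^2 \<Rightarrow> real^2" where
  "band_of_disc x =
     (ln 2 + (ln (1 + x $ 1) - ln (1 - x $ 1)) / 2) *\<^sub>R axis 1 1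
     + arctan (x $ 2 / sqrt (1 - x $ 1 * x $ 1 - x $ 2 * x $ 2)) *\<^sub>R axis 2 1"

text \<open>With \<open>u = z $ 1 - ln 2\<close>, the coefficients are tanh u and
  \<open>sin (z $ 2)\<close> / cosh u, rewritten through \<open>exp (z $ 1)\<close>, which is 2 exp
  u.\<close>

definition disc_of_band :: "real^2 \<Rightarrow> real^2" where
  "disc_of_band z =
     ((exp (2 * z $ 1) - 4) / (exp (2 * z $ 1) + 4)) *\<^sub>R axis 1 1
     + (4 * exp (z $ 1) * sin (z $ 2) / (exp (2 * z $ 1) + 4)) *\<^sub>R axis 2 1"

lemma band_of_disc_nth:
  "band_of_disc x $ 1 = ln 2 + (ln (1 + x $ 1) - ln (1 - x $ 1)) / 2"
  "band_of_disc x $ 2 = arctan (x $ 2 / sqrt (1 - x $ 1 * x $ 1 - x $ 2 * x $ 2))"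
  by (simp_all add: band_of_disc_def axis_def)

lemma disc_of_band_nth:
  "disc_of_band z $ 1 = (exp (2 * z $ 1) - 4) / (exp (2 * z $ 1) + 4)"
  "disc_of_band z $ 2 = 4 * exp (z $ 1) * sin (z $ 2) / (exp (2 * z $ 1) + 4)"
  by (simp_all add: disc_of_band_def axis_def)

lemma smooth_on_band_of_disc: "smooth_on disc band_of_disc"
proof -
  have pos: "0 < 1 - x $ 1 * x $ 1 - x $ 2 * x $ 2" if "x \<in> disc" for x
    using that by (simp add: disc_iff power2_eq_square)
  show ?thesis
    unfolding band_of_disc_def
    by (intro smooth_on_add smooth_on_scaleR smooth_on_minus smooth_on_divide smooth_on_mult
        smooth_on_compose[OF smooth_on_ln] smooth_on_compose[OF smooth_on_arctan]
        smooth_on_compose[OF smooth_on_sqrt] smooth_on_const open_disc open_UNIV open_greaterThan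
        smooth_on_bounded_linear bounded_linear_vec_nth UNIV_I)
      (auto dest: disc_fst_bounds pos)
qed

lemma smooth_on_disc_of_band: "smooth_on band disc_of_band"
proof -
  have nz: "exp (r::real) + 4 \<noteq> 0" for r
    using exp_gt_zero[of r] by linarith
  show ?thesis
    unfolding disc_of_band_def
    by (intro smooth_on_add smooth_on_scaleR smooth_on_minus smooth_on_divide smooth_on_mult
        smooth_on_compose[OF smooth_on_exp] smooth_on_compose[OF smooth_on_sin]
        smooth_on_const open_band open_UNIV
        smooth_on_bounded_linear bounded_linear_vec_nth UNIV_I nz)
qed

section \<open>The two maps are mutually inverse\<close>

text \<open>The exponentials of the logarithms become algebraic. Expanding the first fraction by
  \<open>1 - x $ 1\<close> shows it to be the square of the second, and both roots are
  nonnegative.\<close>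

lemma exp_band_of_disc:
  assumes "x \<in> disc"
  shows "exp (2 * band_of_disc x $ 1) = 4 * (1 + x $ 1) / (1 - x $ 1)"
    and "exp (band_of_disc x $ 1) = 2 * sqrt (1 - (x $ 1)\<^sup>2) / (1 - x $ 1)"
proof -
  note b = disc_fst_bounds[OF assms]
  have "ln 4 = 2 * ln (2::real)"
    using ln_realpow[of "2::real" 2] by simp
  then have "2 * band_of_disc x $ 1 = ln 4 + ln (1 + x $ 1) - ln (1 - x $ 1)"
    by (simp add: band_of_disc_nth)
  then show 1: "exp (2 * band_of_disc x $ 1) = 4 * (1 + x $ 1) / (1 - x $ 1)"
    using b by (simp add: exp_add exp_diff)
  have "(exp (band_of_disc x $ 1))\<^sup>2 = 4 * (1 + x $ 1) / (1 - x $ 1)"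
    using 1 by (simp add: exp_double)
  also have "\<dots> = (2 * sqrt (1 - (x $ 1)\<^sup>2) / (1 - x $ 1))\<^sup>2"
  proof -
    have "1 - (x $ 1)\<^sup>2 \<ge> 0" using b by (simp add: abs_square_le_1)
    then have "(2 * sqrt (1 - (x $ 1)\<^sup>2) / (1 - x $ 1))\<^sup>2 = 4 * ((1 + x $ 1) * (1 - x $ 1)) / (1 - x $ 1)\<^sup>2"
      by (simp add: power_mult_distrib power_divide) (simp add: algebra_simps power2_eq_square)
    then show ?thesis using b by (simp add: power2_eq_square)
  qed
  finally show "exp (band_of_disc x $ 1) = 2 * sqrt (1 - (x $ 1)\<^sup>2) / (1 - x $ 1)"
    using b by (subst (asm) power2_eq_iff_nonneg) (auto simp: abs_square_le_1)
qed

text \<open>For \<open>t = x $ 2 / s\<close> the arctangent has cosine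
  \<open>1 / sqrt (1 + t^2)\<close> and sine \<open>t / sqrt (1 + t^2)\<close>, and this root equals
  \<open>sqrt (1 - (x $ 1)^2) / s\<close>.\<close>

lemma cos_sin_band_of_disc:
  assumes "x \<in> disc"
  shows "cos (band_of_disc x $ 2) = sqrt (1 - (x $ 1)\<^sup>2 - (x $ 2)\<^sup>2) / sqrt (1 - (x $ 1)\<^sup>2)"
    and "sin (band_of_disc x $ 2) = x $ 2 / sqrt (1 - (x $ 1)\<^sup>2)"
proof -
  define s where "s = sqrt (1 - (x $ 1)\<^sup>2 - (x $ 2)\<^sup>2)"
  have s: "s > 0" "s\<^sup>2 = 1 - (x $ 1)\<^sup>2 - (x $ 2)\<^sup>2"
    using assms by (auto simp: s_def disc_iff)
  have y: "band_of_disc x $ 2 = arctan (x $ 2 / s)"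
    by (simp add: band_of_disc_nth s_def power2_eq_square)
  have "1 + (x $ 2 / s)\<^sup>2 = (1 - (x $ 1)\<^sup>2) / s\<^sup>2"
    using s by (simp add: power_divide field_simps)
  then have "sqrt (1 + (x $ 2 / s)\<^sup>2) = sqrt (1 - (x $ 1)\<^sup>2) / s"
    using s(1) by (simp add: real_sqrt_divide)
  then show "cos (band_of_disc x $ 2) = sqrt (1 - (x $ 1)\<^sup>2 - (x $ 2)\<^sup>2) / sqrt (1 - (x $ 1)\<^sup>2)"
    and "sin (band_of_disc x $ 2) = x $ 2 / sqrt (1 - (x $ 1)\<^sup>2)"
    using s(1) by (simp_all add: y cos_arctan sin_arctan flip: s_def)
qed

lemma band_of_disc_in_band: "band_of_disc x \<in> band"
  using arctan_bounded by (simp add: band_def band_of_disc_nth)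

text \<open>Both sides of the identity are the inverse square of the hyperboloid coordinate
  \<open>X\<^sub>0\<close>. For \<open>e = exp (z $ 1)\<close> it follows from
  \<open>(e^2 + 4)^2 - (e^2 - 4)^2 = 16 * e^2\<close> and \<open>sin^2 + cos^2 = 1\<close>.
  Positivity of the right side gives membership in the disc.\<close>

lemma disc_of_band_in_disc:
  assumes "z \<in> band"
  shows "1 - (disc_of_band z $ 1)\<^sup>2 - (disc_of_band z $ 2)\<^sup>2
      = (4 * exp (z $ 1) * cos (z $ 2) / (exp (2 * z $ 1) + 4))\<^sup>2"
    and "disc_of_band z \<in> disc"
proof -
  define e where "e = exp (z $ 1)"
  have e: "e > 0" "exp (2 * z $ 1) = e\<^sup>2" by (simp_all add: e_def exp_double)
  have p: "e\<^sup>2 + 4 > 0" using e by (simp add: add_pos_pos)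
  have c: "cos (z $ 2) > 0" using assms by (auto simp: band_def intro: cos_gt_zero_pi)
  have s: "(sin (z $ 2))\<^sup>2 = 1 - (cos (z $ 2))\<^sup>2" by (simp add: sin_squared_eq)
  show 1: "1 - (disc_of_band z $ 1)\<^sup>2 - (disc_of_band z $ 2)\<^sup>2
      = (4 * exp (z $ 1) * cos (z $ 2) / (exp (2 * z $ 1) + 4))\<^sup>2"
    using p unfolding disc_of_band_nth e(2) e_def[symmetric] power_divide power_mult_distrib s
    by (simp add: divide_simps) (simp add: power2_eq_square algebra_simps)
  have "(4 * exp (z $ 1) * cos (z $ 2) / (exp (2 * z $ 1) + 4))\<^sup>2 > 0"
    using p c e by (intro zero_less_power divide_pos_pos mult_pos_pos) simp_all
  then show "disc_of_band z \<in> disc"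
    unfolding 1[symmetric] disc_iff by simp
qed

text \<open>The common denominator becomes \<open>8 / (1 - x $ 1)\<close>, and the numerators become
  \<open>8 * x $ 1 / (1 - x $ 1)\<close> and \<open>8 * x $ 2 / (1 - x $ 1)\<close>.\<close>

lemma disc_of_band_of_disc:
  assumes "x \<in> disc"
  shows "disc_of_band (band_of_disc x) = x"
proof -
  note b = disc_fst_bounds[OF assms]
  define w where "w = sqrt (1 - (x $ 1)\<^sup>2)"
  have "(x $ 1)\<^sup>2 < 1" using b by (auto simp: abs_square_less_1)
  then have w: "w > 0" by (simp add: w_def)
  have d: "exp (2 * band_of_disc x $ 1) + 4 = 8 / (1 - x $ 1)"
    using b by (simp add: exp_band_of_disc[OF assms] field_simps)
  have "disc_of_band (band_of_disc x) $ 1 = x $ 1"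
    using b unfolding disc_of_band_nth d by (simp add: exp_band_of_disc[OF assms] field_simps)
  moreover have "disc_of_band (band_of_disc x) $ 2 = x $ 2"
    using b w unfolding disc_of_band_nth d exp_band_of_disc(2)[OF assms]
      cos_sin_band_of_disc(2)[OF assms] w_def[symmetric] by (simp add: field_simps)
  ultimately show ?thesis
    by (simp add: vec_eq_iff forall_2)
qed

text \<open>First coordinates are compared through the injective \<open>exp\<close>. For the second,
  the argument of \<open>arctan\<close> is \<open>tan (z $ 2)\<close>, and the band is exactly where
  \<open>arctan\<close> inverts \<open>tan\<close>.\<close>

lemma band_of_disc_of_band:
  assumes "z \<in> band"
  shows "band_of_disc (disc_of_band z) = z"
proof -
  define e where "e = exp (z $ 1)"
  have e: "e > 0" "exp (2 * z $ 1) = e\<^sup>2" by (simp_all add: e_def exp_double)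
  have p: "e\<^sup>2 + 4 > 0" using e by (simp add: add_pos_pos)
  have c: "cos (z $ 2) > 0" using assms by (auto simp: band_def intro: cos_gt_zero_pi)
  let ?x = "disc_of_band z"
  have "exp (2 * band_of_disc ?x $ 1) = 4 * (1 + ?x $ 1) / (1 - ?x $ 1)"
    by (rule exp_band_of_disc(1)[OF disc_of_band_in_disc(2)[OF assms]])
  also have "\<dots> = exp (2 * z $ 1)"
    using p by (simp add: disc_of_band_nth e(2) divide_simps)
  finally have 1: "band_of_disc ?x $ 1 = z $ 1"
    by simp
  have "sqrt (1 - ?x $ 1 * ?x $ 1 - ?x $ 2 * ?x $ 2) = 4 * e * cos (z $ 2) / (e\<^sup>2 + 4)"
    using disc_of_band_in_disc(1)[OF assms] c e p
    by (simp add: e_def[symmetric] flip: power2_eq_square)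
  then have "?x $ 2 / sqrt (1 - ?x $ 1 * ?x $ 1 - ?x $ 2 * ?x $ 2) = tan (z $ 2)"
    using c e p by (simp add: disc_of_band_nth e_def[symmetric] tan_def)
  then have "band_of_disc ?x $ 2 = z $ 2"
    using assms by (simp add: band_of_disc_nth arctan_tan band_def)
  then show ?thesis
    using 1 by (simp add: vec_eq_iff forall_2)
qed

lemma diffeomorphism_band_of_disc: "diffeomorphism disc band band_of_disc"
proof -
  have cont: "continuous_on S f" if "smooth_on S f" for S and f :: "real^2 \<Rightarrow> real^2"
    using that Ck_on.simps(1) unfolding smooth_on_def by blast
  have "homeomorphism disc band band_of_disc disc_of_band"
    by (rule homeomorphismI)
      (auto simp: cont smooth_on_band_of_disc smooth_on_disc_of_band band_of_disc_in_band
        disc_of_band_in_disc disc_of_band_of_disc band_of_disc_of_band)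
  then show ?thesis
    unfolding diffeomorphism_def
    using open_disc open_band smooth_on_band_of_disc smooth_on_disc_of_band by blast
qed

section \<open>The derivative and the comparison of the Finsler structures\<close>

text \<open>The first component is the derivative of artanh. In the second, the quotient contributes
  a denominator \<open>s^3\<close> and the arctangent a factor \<open>s^2 / w\<close>, since
  \<open>s^2 + (x $ 2)^2 = w\<close>.\<close>

lemma has_derivative_band_of_disc:
  assumes "x \<in> disc"
  defines "w \<equiv> 1 - (x $ 1)\<^sup>2" and "s \<equiv> sqrt (1 - (x $ 1)\<^sup>2 - (x $ 2)\<^sup>2)"
  shows "(band_of_disc has_derivative
    (\<lambda>v. (v $ 1 / w) *\<^sub>R axis 1 1 + ((w * v $ 2 + x $ 1 * x $ 2 * v $ 1) / (s * w)) *\<^sub>R axis 2 1)) (at x)"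
proof -
  note b = disc_fst_bounds[OF assms(1)]
  have r: "1 - x $ 1 * x $ 1 - x $ 2 * x $ 2 > 0"
    using assms(1) by (simp add: disc_iff power2_eq_square)
  have s: "s > 0" "s\<^sup>2 = w - (x $ 2)\<^sup>2" "sqrt (1 - x $ 1 * x $ 1 - x $ 2 * x $ 2) = s"
    using r by (auto simp: s_def w_def power2_eq_square)
  have w: "w > 0" "w = (1 + x $ 1) * (1 - x $ 1)"
    using b by (auto simp: w_def abs_square_less_1) (simp add: algebra_simps power2_eq_square)
  have 1: "((\<lambda>x::real^2. ln 2 + (ln (1 + x $ 1) - ln (1 - x $ 1)) / 2) has_derivative
      (\<lambda>v. v $ 1 / w)) (at x)"
  proof -
    have ln: "((\<lambda>x::real^2. ln (1 + x $ 1)) has_derivative (\<lambda>v. v $ 1 / (1 + x $ 1))) (at x)"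
      "((\<lambda>x::real^2. ln (1 - x $ 1)) has_derivative (\<lambda>v. - (v $ 1 / (1 - x $ 1)))) (at x)"
      using b by (auto intro!: derivative_eq_intros bounded_linear.has_derivative[OF bounded_linear_vec_nth]
          simp: fun_eq_iff divide_inverse)
    have "r / (1 + x $ 1) + r / (1 - x $ 1) = 2 * r / w" for r
      using b unfolding w(2) by (subst add_frac_eq) (simp_all add: algebra_simps)
    then have "(r / (1 + x $ 1) + r / (1 - x $ 1)) / 2 = r / w" for r
      by simp
    moreover have "((\<lambda>x::real^2. ln 2 + (ln (1 + x $ 1) - ln (1 - x $ 1)) / 2) has_derivative
        (\<lambda>v. (v $ 1 / (1 + x $ 1) + v $ 1 / (1 - x $ 1)) / 2)) (at x)"
      using has_derivative_add[OF has_derivative_const[of "ln 2"]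
          bounded_linear.has_derivative[OF bounded_linear_divide has_derivative_diff[OF ln], of 2]]
      by simp
    ultimately show ?thesis
      by simp
  qed
  have root: "((\<lambda>x::real^2. sqrt (1 - x $ 1 * x $ 1 - x $ 2 * x $ 2)) has_derivative
      (\<lambda>v. - (x $ 1 * v $ 1 + x $ 2 * v $ 2) / s)) (at x)"
    using r s(1,3) by (auto intro!: derivative_eq_intros bounded_linear.has_derivative[OF bounded_linear_vec_nth]
        simp: fun_eq_iff field_simps)
  have quot: "((\<lambda>x::real^2. x $ 2 / sqrt (1 - x $ 1 * x $ 1 - x $ 2 * x $ 2)) has_derivative
      (\<lambda>v. (w * v $ 2 + x $ 1 * x $ 2 * v $ 1) / s ^ 3)) (at x)"
  proof -
    have eq: "(v $ 2 * s - x $ 2 * (- (x $ 1 * v $ 1 + x $ 2 * v $ 2) / s)) / (s * s)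
        = (w * v $ 2 + x $ 1 * x $ 2 * v $ 1) / s ^ 3" for v :: "real^2"
    proof -
      \<comment> \<open>The numerator contains \<open>v $ 2\<close> with coefficient
        \<open>s^2 + (x $ 2)^2\<close>, which this collapses to \<open>w\<close>.\<close>
      have "w = s\<^sup>2 + (x $ 2)\<^sup>2" using s by simp
      then show ?thesis
        using s(1) by (simp add: field_simps power2_eq_square power3_eq_cube)
    qed
    have "sqrt (1 - x $ 1 * x $ 1 - x $ 2 * x $ 2) \<noteq> 0"
      using s by simp
    from has_derivative_divide'[OF bounded_linear.has_derivative[OF bounded_linear_vec_nth has_derivative_ident]
        root this, of 2]
    show ?thesis
      unfolding s(3) eq .
  qed
  have "((\<lambda>x::real^2. arctan (x $ 2 / sqrt (1 - x $ 1 * x $ 1 - x $ 2 * x $ 2))) has_derivative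
      (\<lambda>v. (w * v $ 2 + x $ 1 * x $ 2 * v $ 1) / (s * w))) (at x)"
  proof -
    have "1 + (x $ 2 / s)\<^sup>2 = w / s\<^sup>2"
      using s(1,2) by (simp add: power_divide field_simps)
    then have "(w * v $ 2 + x $ 1 * x $ 2 * v $ 1) / s ^ 3 * inverse (1 + (x $ 2 / s)\<^sup>2)
        = (w * v $ 2 + x $ 1 * x $ 2 * v $ 1) / (s * w)" for v :: "real^2"
      using s(1) w(1) by (simp add: field_simps power2_eq_square power3_eq_cube)
    then show ?thesis
      using has_derivative_arctan[OF quot] unfolding s(3) by (simp add: mult.commute)
  qed
  then show ?thesis
    unfolding band_of_disc_def[abs_def]
    by (intro has_derivative_add has_derivative_scaleR_left 1)
qed

text \<open>The two summands match separately: fact \<open>A\<close> compares the Riemannian norms,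
  fact \<open>B\<close> the 1-forms.\<close>

lemma F_B_band_of_disc:
  assumes "x \<in> disc"
  shows "F_B (band_of_disc x) (frechet_derivative band_of_disc (at x) v) = F_F x v"
proof -
  define w where "w = 1 - (x $ 1)\<^sup>2"
  define s where "s = sqrt (1 - (x $ 1)\<^sup>2 - (x $ 2)\<^sup>2)"
  define u where "u = frechet_derivative band_of_disc (at x) v"
  note b = disc_fst_bounds[OF assms]
  have s: "s > 0" "s\<^sup>2 = w - (x $ 2)\<^sup>2"
    using assms by (auto simp: s_def w_def disc_iff)
  have w: "w > 0"
    using b by (auto simp: w_def abs_square_less_1)
  have "u = (v $ 1 / w) *\<^sub>R axis 1 1 + ((w * v $ 2 + x $ 1 * x $ 2 * v $ 1) / (s * w)) *\<^sub>R axis 2 1"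
    unfolding u_def w_def s_def
    by (simp flip: frechet_derivative_at[OF has_derivative_band_of_disc[OF assms]])
  then have u: "u $ 1 = v $ 1 / w" "u $ 2 = (w * v $ 2 + x $ 1 * x $ 2 * v $ 1) / (s * w)"
    by (simp_all add: axis_def)
  let ?z = "band_of_disc x"
  have cs: "cos (?z $ 2) = s / sqrt w" "sin (?z $ 2) = x $ 2 / sqrt w"
    by (simp_all add: cos_sin_band_of_disc[OF assms] s_def w_def)
  have inn: "x \<bullet> v = x $ 1 * v $ 1 + x $ 2 * v $ 2"
    by (simp add: inner_vec_def sum_2)
  have nx: "1 - (norm x)\<^sup>2 = s\<^sup>2"
    unfolding norm_power2_vec2 s(2) w_def by simp
  \<comment> \<open>This completes the square in \<open>v $ 2\<close>, whose square has coefficient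
    \<open>w\<close> in the quadratic form under the root of \<open>F_F\<close>.\<close>
  have key: "w * (s\<^sup>2 * (norm v)\<^sup>2 + (x \<bullet> v)\<^sup>2)
      = s\<^sup>2 * (v $ 1)\<^sup>2 + (w * v $ 2 + x $ 1 * x $ 2 * v $ 1)\<^sup>2"
    unfolding norm_power2_vec2 inn s(2) w_def by (simp add: power2_eq_square algebra_simps)
  have "(norm u)\<^sup>2 = (s\<^sup>2 * (norm v)\<^sup>2 + (x \<bullet> v)\<^sup>2) / (s\<^sup>2 * w)"
  proof -
    have "(norm u)\<^sup>2 = (s\<^sup>2 * (v $ 1)\<^sup>2 + (w * v $ 2 + x $ 1 * x $ 2 * v $ 1)\<^sup>2) / (s\<^sup>2 * w\<^sup>2)"
      unfolding norm_power2_vec2[of u] u power_divide power_mult_distrib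
      using s(1) w by (simp add: divide_simps)
    then show ?thesis
      unfolding key[symmetric] using w by (simp add: power2_eq_square)
  qed
  then have "sqrt ((norm u)\<^sup>2) = sqrt ((s\<^sup>2 * (norm v)\<^sup>2 + (x \<bullet> v)\<^sup>2) / (s\<^sup>2 * w))"
    by (rule arg_cong)
  then have "norm u = sqrt (s\<^sup>2 * (norm v)\<^sup>2 + (x \<bullet> v)\<^sup>2) / (s * sqrt w)"
    using s(1) by (simp add: real_sqrt_divide real_sqrt_mult)
  then have A: "norm u / cos (?z $ 2) = sqrt (s\<^sup>2 * (norm v)\<^sup>2 + (x \<bullet> v)\<^sup>2) / s\<^sup>2"
    using s(1) w unfolding cs by (simp add: power2_eq_square)
  \<comment> \<open>The ratio \<open>(E - 4) / (E + 4)\<close> is tanh u, that is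
    \<open>x $ 1\<close>. Hence the 1-form of the band has coefficients \<open>x $ 1\<close> and the
    tangent of the second band coordinate.\<close>
  define E where "E = exp (2 * ?z $ 1)"
  have E: "E > 0" "E - 4 = x $ 1 * (E + 4)"
    using b by (simp_all add: E_def exp_band_of_disc[OF assms] field_simps)
  have cpos: "cos (?z $ 2) > 0"
    using s(1) w by (simp add: cs)
  have "((E - 4) * u $ 1 * cos (?z $ 2) + (E + 4) * u $ 2 * sin (?z $ 2)) / ((E + 4) * cos (?z $ 2))
      = x $ 1 * u $ 1 + u $ 2 * (sin (?z $ 2) / cos (?z $ 2))"
  proof -
    have "(x $ 1 * G * p * c + G * q * d) / (G * c) = x $ 1 * p + q * (d / c)"
      if "G > 0" "c > 0" for G p q c d :: real
      using that by (simp add: field_simps)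
    then show ?thesis
      unfolding E(2) using E(1) cpos by simp
  qed
  also have "sin (?z $ 2) / cos (?z $ 2) = x $ 2 / s"
    using s(1) w by (simp add: cs)
  also have "x $ 1 * u $ 1 + u $ 2 * (x $ 2 / s)
      = (x $ 1 * v $ 1 * (s\<^sup>2 + (x $ 2)\<^sup>2) + w * x $ 2 * v $ 2) / (s\<^sup>2 * w)"
    unfolding u using s(1) w by (simp add: field_simps power2_eq_square)
  \<comment> \<open>Since \<open>s^2 + (x $ 2)^2 = w\<close>, the numerator is
    \<open>w * (x \<bullet> v)\<close> and \<open>w\<close> cancels.\<close>
  also have "\<dots> = (x \<bullet> v) / s\<^sup>2"
    using s w unfolding inn by (simp add: field_simps)
  finally have B: "((E - 4) * u $ 1 * cos (?z $ 2) + (E + 4) * u $ 2 * sin (?z $ 2))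
      / ((E + 4) * cos (?z $ 2)) = (x \<bullet> v) / s\<^sup>2" .
  show ?thesis
    unfolding F_B_def F_F_def u_def[symmetric] nx E_def[symmetric] A B ..
qed

theorem theorem3p1:
  "\<exists>\<xi> :: real^2 \<Rightarrow> real^2. finsler_isometry disc F_F band F_B \<xi>"
  unfolding finsler_isometry_def using diffeomorphism_band_of_disc F_B_band_of_disc by blast

end
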